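(* Let $G$ be a unicyclic graph whose unique cycle is $C_n$ (a cycle of length $n$), with $n\neq 3,5$. If $G$ is vertex decomposable, then for every integer $k\ge 1$ the graph $G(\mathbf{k})$ is also vertex decomposable.
   Context: All graphs are finite and simple. A unicyclic graph is a connected graph containing exactly one cycle. Construction of $G(\mathbf{k})$: let $G$ be a simple graph with vertices $x_1,\ldots,x_m$ and edges $e_1,\ldots,e_t$. For an edge $e=\{x_i,x_j\}$ of $G$ and an integer $p\ge 1$, let $e(p)$ be the graph with vertex set $V(e(p))=\{x_{s,a}: s\in\{i,j\},\ 1\le a\le p\}$ and edge set $E(e(p))=\{\{x_{i,l},x_{j,q}\}: 1\le l,q\le p,\ l+q\le p+1\}$. For an integer $k\ge 1$, $G(\mathbf{k})$ is the graph with vertex set $\bigcup_{i=1}^t V(e_i(k))$ and edge set $\bigcup_{i=1}^t E(e_i(k))$ (vertices with the same label $x_{s,a}$ coming from different edges are the same vertex). Vertex decomposable graphs: for a vertex $x$ of a graph $H$, $N_H(x)$ is the set of vertices adjacent to $x$, and $N_H[x]=N_H(x)\cup\{x\}$. For $K\subset V(H)$, $H\setminus K$ is the induced subgraph on $V(H)\setminus K$. A graph $H$ is (recursively) called vertex decomposable if it has no edges, or there is a vertex $x$ of $H$ such that (i) $H\setminus\{x\}$ and $H\setminus N_H[x]$ are vertex decomposable, and (ii) for every independent set $C$ in $H\setminus N_H[x]$ there exists $y\in N_H(x)$ such that $C\cup\{y\}$ is independent in $H\setminus\{x\}$. *)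

theory Defs
  imports Main
begin

datatype 'a ugraph = UGraph (verts: "'a set") (edges: "'a set set")

definition simple_graph :: "'a ugraph \<Rightarrow> bool" where
  "simple_graph G \<longleftrightarrow>
     finite (verts G) \<and> (\<forall>e\<in>edges G. e \<subseteq> verts G \<and> card e = 2)"

definition subgraph :: "'a ugraph \<Rightarrow> 'a ugraph \<Rightarrow> bool" where
  "subgraph H G \<longleftrightarrow> verts H \<subseteq> verts G \<and> edges H \<subseteq> edges G"

definition connected_graph :: "'a ugraph \<Rightarrow> bool" where
  "connected_graph G \<longleftrightarrow>
     verts G \<noteq> {} \<and>
     (\<forall>u\<in>verts G. \<forall>v\<in>verts G. (u, v) \<in> {(a, b). {a, b} \<in> edges G}\<^sup>*)"

definition cycle_graph :: "'a list \<Rightarrow> 'a ugraph" where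
  "cycle_graph vs =
     UGraph (set vs) {{vs ! i, vs ! (Suc i mod length vs)} |i. i < length vs}"

(* Cycles are subgraphs rather than vertex sequences, so that rotations and
   reversals of a sequence give the same cycle and cycles can be counted. *)
definition is_cycle_of :: "'a ugraph \<Rightarrow> 'a ugraph \<Rightarrow> bool" where
  "is_cycle_of C G \<longleftrightarrow>
     subgraph C G \<and> (\<exists>vs. distinct vs \<and> length vs \<ge> 3 \<and> C = cycle_graph vs)"

definition unicyclic :: "'a ugraph \<Rightarrow> bool" where
  "unicyclic G \<longleftrightarrow> simple_graph G \<and> connected_graph G \<and> (\<exists>!C. is_cycle_of C G)"

(* The vertex x_{s,a} is represented by the pair (x_s, a). *)
definition edge_expansion :: "'a set \<Rightarrow> nat \<Rightarrow> ('a \<times> nat) ugraph" where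
  "edge_expansion e p =
     UGraph (e \<times> {1..p})
       {{(u, l), (v, q)} |u v l q.
          e = {u, v} \<and> l \<in> {1..p} \<and> q \<in> {1..p} \<and> l + q \<le> p + 1}"

definition graph_expansion :: "'a ugraph \<Rightarrow> nat \<Rightarrow> ('a \<times> nat) ugraph" where
  "graph_expansion G k =
     UGraph (\<Union>e\<in>edges G. verts (edge_expansion e k))
            (\<Union>e\<in>edges G. edges (edge_expansion e k))"

definition nbhd :: "'a ugraph \<Rightarrow> 'a \<Rightarrow> 'a set" where
  "nbhd H x = {y. {x, y} \<in> edges H}"

definition closed_nbhd :: "'a ugraph \<Rightarrow> 'a \<Rightarrow> 'a set" where
  "closed_nbhd H x = nbhd H x \<union> {x}"

definition delete_verts :: "'a ugraph \<Rightarrow> 'a set \<Rightarrow> 'a ugraph" where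
  "delete_verts H K = UGraph (verts H - K) {e \<in> edges H. e \<subseteq> verts H - K}"

definition independent :: "'a ugraph \<Rightarrow> 'a set \<Rightarrow> bool" where
  "independent H C \<longleftrightarrow> C \<subseteq> verts H \<and> (\<forall>u\<in>C. \<forall>v\<in>C. {u, v} \<notin> edges H)"

(* On finite graphs the recursion is well-founded (vertices are deleted), so
   the least fixed point is the recursively defined property. *)
inductive vertex_decomposable :: "'a ugraph \<Rightarrow> bool" where
  no_edges: "edges H = {} \<Longrightarrow> vertex_decomposable H"
| shedding: "\<lbrakk> x \<in> verts H;
     vertex_decomposable (delete_verts H {x});
     vertex_decomposable (delete_verts H (closed_nbhd H x));
     \<forall>C. independent (delete_verts H (closed_nbhd H x)) C \<longrightarrow>
         (\<exists>y\<in>nbhd H x. independent (delete_verts H {x}) (C \<union> {y})) \<rbrakk>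
   \<Longrightarrow> vertex_decomposable H"

end

theory Submission imports Defs begin

text \<open>Two observations carry the proof.

  First, some vertex \<open>p\<close> of the cycle is adjacent to a leaf \<open>z\<close> of \<open>G\<close>
  (\<open>cycle_vertex_carries_leaf\<close>). Deleting the closed neighbourhoods of an independent set
  preserves vertex decomposability (\<open>vertex_decomposable_link\<close>). If no cycle vertex were
  adjacent to a leaf, the vertices at distance two from the cycle would dominate all those
  at distance one, so that a suitable independent set would dominate exactly the vertices
  off the cycle. The cycle would remain, but a cycle of length other than 3 and 5 has no
  shedding vertex (\<open>cycle_graph_not_vertex_decomposable\<close>).

  Second, the subgraphs of the expansion obtained by deleting the levels \<open>1, ..., l v\<close> over
  each vertex \<open>v\<close> form a family that is closed under shedding. Call an edge \<open>{u, v}\<close> of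
  \<open>G\<close> live if \<open>l u + l v < k\<close>, that is, if some edge over it is left. Whenever the live edges have a
  leaf \<open>z\<close> with neighbour \<open>y\<close>, the vertex \<open>(z, k - l y)\<close> is a leaf of the truncated
  expansion. Its neighbour \<open>(y, l y + 1)\<close> is therefore shedding, and both graphs of the
  recursion are truncations with larger \<open>l\<close>
  (\<open>vertex_decomposable_truncation_step\<close>). If the live edges form a forest, there is always such
  a leaf, and induction shows that the truncation is vertex decomposable.

  In the expansion itself, the leaf \<open>z\<close> allows the vertices over \<open>p\<close> to be shed one level after
  another. Deleting the closed neighbourhood of one of them, or all of them in turn, leaves
  no live edge at \<open>p\<close>; since every cycle passes through \<open>p\<close>, a forest remains.\<close>

section \<open>Deleting vertices\<close>

lemma verts_delete [simp]: "verts (delete_verts H K) = verts H - K"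
  by (simp add: delete_verts_def)

lemma edges_delete [simp]: "edges (delete_verts H K) = {e \<in> edges H. e \<subseteq> verts H - K}"
  by (simp add: delete_verts_def)

lemma simple_graph_delete: "simple_graph H \<Longrightarrow> simple_graph (delete_verts H K)"
  by (auto simp: simple_graph_def)

lemma delete_delete: "delete_verts (delete_verts H K) L = delete_verts H (K \<union> L)"
  by (auto simp: delete_verts_def)

lemma delete_cong: "verts H - K = verts H - L \<Longrightarrow> delete_verts H K = delete_verts H L"
  by (simp add: delete_verts_def)

lemma independent_delete:
  "independent (delete_verts H K) D \<longleftrightarrow> independent H D \<and> D \<inter> K = {}"
  unfolding independent_def verts_delete edges_delete by blast

lemma edge_in_verts: "simple_graph H \<Longrightarrow> {x, y} \<in> edges H \<Longrightarrow> x \<in> verts H \<and> y \<in> verts H"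
  unfolding simple_graph_def by blast

lemma edge_distinct: "simple_graph H \<Longrightarrow> {x, y} \<in> edges H \<Longrightarrow> x \<noteq> y"
  unfolding simple_graph_def by fastforce

lemma mem_nbhd [simp]: "y \<in> nbhd H x \<longleftrightarrow> {x, y} \<in> edges H"
  by (simp add: nbhd_def)

lemma mem_closed_nbhd [simp]: "y \<in> closed_nbhd H x \<longleftrightarrow> y = x \<or> {x, y} \<in> edges H"
  by (auto simp: closed_nbhd_def)

section \<open>Vertex decomposability of links and of cycles\<close>

text \<open>A shedding vertex \<open>x\<close> of \<open>H\<close> that survives the deletion of the closed
  neighbourhoods of \<open>S\<close> is still shedding there: the condition for an independent set \<open>D\<close>
  follows from the condition in \<open>H\<close> for \<open>D \<union> S\<close>, because a neighbour of \<open>x\<close> that is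
  compatible with \<open>S\<close> has survived as well. If \<open>x\<close> is itself deleted, one of the two
  smaller graphs in the recursion takes its place.\<close>

lemma vertex_decomposable_link:
  assumes "vertex_decomposable H" "simple_graph H" "independent H S"
  shows "vertex_decomposable (delete_verts H (\<Union>s\<in>S. closed_nbhd H s))"
  using assms
proof (induction arbitrary: S rule: vertex_decomposable.induct)
  case (no_edges H)
  then show ?case by (intro vertex_decomposable.no_edges) simp
next
  case (shedding x H)
  let ?N = "\<Union>s\<in>S. closed_nbhd H s"
  let ?H1 = "delete_verts H {x}" and ?H2 = "delete_verts H (closed_nbhd H x)"
  have S: "S \<subseteq> verts H" "\<And>u v. u \<in> S \<Longrightarrow> v \<in> S \<Longrightarrow> {u, v} \<notin> edges H"
    using shedding.prems(2) by (auto simp: independent_def)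
  have in1: "vertex_decomposable (delete_verts H ({x} \<union> ?N))" if "x \<notin> S"
  proof -
    have "independent ?H1 S" using S that by (auto simp: independent_def)
    with shedding.IH(1) simple_graph_delete[OF shedding.prems(1)]
    have "vertex_decomposable (delete_verts ?H1 (\<Union>s\<in>S. closed_nbhd ?H1 s))" by blast
    moreover have "delete_verts ?H1 (\<Union>s\<in>S. closed_nbhd ?H1 s) = delete_verts H ({x} \<union> ?N)"
      unfolding delete_delete using S that
      by (intro delete_cong) (auto dest: edge_in_verts[OF shedding.prems(1)])
    ultimately show ?thesis by simp
  qed
  have in2: "vertex_decomposable (delete_verts H (closed_nbhd H x \<union> ?N))"
    if disj: "S \<inter> nbhd H x = {}"
  proof -
    let ?S = "S - {x}"
    have "independent ?H2 ?S" using S disj by (auto simp: independent_def)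
    with shedding.IH(2) simple_graph_delete[OF shedding.prems(1)]
    have "vertex_decomposable (delete_verts ?H2 (\<Union>s\<in>?S. closed_nbhd ?H2 s))" by blast
    moreover have "closed_nbhd ?H2 s = closed_nbhd H s - closed_nbhd H x" if "s \<in> ?S" for s
    proof -
      have "s \<in> verts H" "s \<notin> closed_nbhd H x" using S(1) that disj by auto
      moreover have "w \<in> verts H" if "{s, w} \<in> edges H" for w
        using edge_in_verts[OF shedding.prems(1) that] by blast
      ultimately show ?thesis by auto
    qed
    then have "delete_verts ?H2 (\<Union>s\<in>?S. closed_nbhd ?H2 s)
        = delete_verts H (closed_nbhd H x \<union> ?N)"
      unfolding delete_delete by (intro delete_cong) auto
    ultimately show ?thesis by simp
  qed
  consider "x \<in> S" | "x \<notin> S" "x \<in> ?N" | "x \<notin> ?N" "x \<notin> S" by blast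
  then show ?case
  proof cases
    case 1
    then have "closed_nbhd H x \<union> ?N = ?N" "S \<inter> nbhd H x = {}" using S by auto
    with in2 show ?thesis by simp
  next
    case 2
    then have "{x} \<union> ?N = ?N" by blast
    with in1 2 show ?thesis by simp
  next
    case 3
    let ?L = "delete_verts H ?N"
    have disj: "S \<inter> nbhd H x = {}" using 3 by (auto simp: insert_commute)
    have nb: "nbhd ?L x = nbhd H x - ?N"
      using 3 shedding.hyps(1) by (auto dest: edge_in_verts[OF shedding.prems(1)])
    have nbc: "closed_nbhd ?L x = closed_nbhd H x - ?N"
      unfolding closed_nbhd_def[of ?L x] nb using 3(1) by (auto simp: nbhd_def)
    show ?thesis
    proof (rule vertex_decomposable.shedding)
      show "x \<in> verts ?L" using 3 shedding.hyps(1) by simp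
      show "vertex_decomposable (delete_verts ?L {x})"
        using in1 3 by (simp add: delete_delete Un_commute)
      have "delete_verts ?L (closed_nbhd ?L x) = delete_verts H (closed_nbhd H x \<union> ?N)"
        unfolding delete_delete nbc by (intro delete_cong) blast
      then show "vertex_decomposable (delete_verts ?L (closed_nbhd ?L x))"
        using in2 disj by simp
      show "\<forall>D. independent (delete_verts ?L (closed_nbhd ?L x)) D \<longrightarrow>
              (\<exists>y\<in>nbhd ?L x. independent (delete_verts ?L {x}) (D \<union> {y}))"
      proof (intro allI impI)
        fix D assume D: "independent (delete_verts ?L (closed_nbhd ?L x)) D"
        have D1: "D \<subseteq> verts H - ?N - closed_nbhd H x"
          using D unfolding independent_def nbc by auto
        then have D2: "{u, v} \<notin> edges H" if "u \<in> D" "v \<in> D" for u v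
          using D that unfolding independent_delete by (simp add: independent_def)
        have D3: "{u, v} \<notin> edges H \<and> {v, u} \<notin> edges H" if "u \<in> D" "v \<in> S" for u v
        proof -
          have "u \<notin> closed_nbhd H v" using D1 that by blast
          then show ?thesis by (auto simp: insert_commute)
        qed
        have "independent ?H2 (D \<union> S)"
          using D1 D2 D3 S disj 3 by (auto simp: independent_def)
        then obtain y where y: "y \<in> nbhd H x" "independent ?H1 (D \<union> S \<union> {y})"
          using shedding.hyps(2-4) by blast
        have ye: "{u, v} \<notin> edges H" if "u \<in> D \<union> S \<union> {y}" "v \<in> D \<union> S \<union> {y}" for u v
          using y(2) that unfolding independent_delete by (auto simp only: independent_def)
        have yS: "y \<notin> ?N" using ye y(1) disj by auto
        have "y \<in> nbhd ?L x" using y(1) yS nb by blast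
        moreover have "independent (delete_verts ?L {x}) (D \<union> {y})"
        proof -
          have "independent H (D \<union> S \<union> {y})" "y \<noteq> x"
            using y(2) unfolding independent_delete by auto
          then have "independent H (D \<union> {y})" unfolding independent_def by blast
          then show ?thesis using D1 yS \<open>y \<noteq> x\<close> unfolding independent_delete by auto
        qed
        ultimately show "\<exists>y\<in>nbhd ?L x. independent (delete_verts ?L {x}) (D \<union> {y})" by blast
      qed
    qed
  qed
qed

text \<open>Indexing a cycle by all integers turns adjacency and equality of its vertices into
  divisibility by its length.\<close>

lemma cycle_graph_integer_indexing:
  assumes "distinct vs" "length vs = n" "n \<ge> 3"
  obtains f :: "int \<Rightarrow> 'a" where
    "verts (cycle_graph vs) = range f"
    "\<And>a b. f a = f b \<longleftrightarrow> int n dvd a - b"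
    "\<And>a b. {f a, f b} \<in> edges (cycle_graph vs)
       \<longleftrightarrow> int n dvd a - b - 1 \<or> int n dvd a - b + 1"
proof
  define f where "f = (\<lambda>j::int. vs ! nat (j mod int n))"
  have lt: "nat (j mod int n) < n" for j using assms(3) by (simp add: nat_less_iff)
  have f_int: "f (int i) = vs ! i" if "i < n" for i using that by (simp add: f_def)
  show "verts (cycle_graph vs) = range f"
  proof
    show "verts (cycle_graph vs) \<subseteq> range f"
      using f_int assms(2) by (auto simp: cycle_graph_def in_set_conv_nth) (metis rangeI)
    show "range f \<subseteq> verts (cycle_graph vs)"
      using lt assms(2) by (auto simp: cycle_graph_def f_def)
  qed
  show eq: "f a = f b \<longleftrightarrow> int n dvd a - b" for a b
  proof -
    have "f a = f b \<longleftrightarrow> nat (a mod int n) = nat (b mod int n)"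
      unfolding f_def using lt assms(1,2) by (simp add: nth_eq_iff_index_eq)
    also have "\<dots> \<longleftrightarrow> a mod int n = b mod int n"
      using assms(3) by (auto simp: nat_eq_iff2)
    finally show ?thesis by (simp add: mod_eq_dvd_iff)
  qed
  have edges: "edges (cycle_graph vs) = {{f c, f (c + 1)} |c. True}"
  proof -
    have step: "vs ! (Suc i mod n) = f (int i + 1)" for i
      by (simp add: f_def nat_mod_distrib nat_add_distrib)
    have "{f c, f (c + 1)} = {vs ! i, vs ! (Suc i mod n)}" if "i = nat (c mod int n)" for i c
    proof -
      have "int i = c mod int n" using that assms(3) by simp
      then have "f (int i + 1) = f (c + 1)" by (simp add: f_def mod_simps)
      then show ?thesis using that step by (simp add: f_def)
    qed
    then have 1: "{f c, f (c + 1)} \<in> edges (cycle_graph vs)" for c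
      using lt assms(2) by (auto simp: cycle_graph_def)
    have 2: "{vs ! i, vs ! (Suc i mod n)} = {f (int i), f (int i + 1)}" if "i < n" for i
      using that step f_int by simp
    show ?thesis using 1 2 assms(2) by (auto simp: cycle_graph_def)
  qed
  show "{f a, f b} \<in> edges (cycle_graph vs)
      \<longleftrightarrow> int n dvd a - b - 1 \<or> int n dvd a - b + 1" for a b
  proof
    assume "{f a, f b} \<in> edges (cycle_graph vs)"
    then obtain c where "{f a, f b} = {f c, f (c + 1)}" using edges by auto
    then have "f a = f c \<and> f b = f (c + 1) \<or> f a = f (c + 1) \<and> f b = f c"
      by (auto simp: doubleton_eq_iff)
    then consider "int n dvd a - c" "int n dvd b - (c + 1)"
      | "int n dvd a - (c + 1)" "int n dvd b - c" by (auto simp: eq)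
    then show "int n dvd a - b - 1 \<or> int n dvd a - b + 1"
    proof cases
      case 1
      from dvd_diff[OF 1] show ?thesis by (simp add: algebra_simps)
    next
      case 2
      from dvd_diff[OF 2] show ?thesis by (simp add: algebra_simps)
    qed
  next
    assume "int n dvd a - b - 1 \<or> int n dvd a - b + 1"
    then have "f a = f (b + 1) \<or> f b = f (a + 1)"
      unfolding eq by (auto simp: algebra_simps dvd_diff_commute)
    then show "{f a, f b} \<in> edges (cycle_graph vs)" unfolding edges by auto
  qed
qed

text \<open>No vertex of the cycle is shedding. The two vertices at distance two from \<open>f i\<close>
  dominate both neighbours of \<open>f i\<close>; they coincide if the length is 4, and they form an
  independent set outside the closed neighbourhood of \<open>f i\<close> unless the length is 3 or 5.\<close>

lemma cycle_graph_not_vertex_decomposable: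
  assumes "distinct vs" "length vs = n" "n \<ge> 3" "n \<noteq> 3" "n \<noteq> 5"
  shows "\<not> vertex_decomposable (cycle_graph vs)"
proof
  assume "vertex_decomposable (cycle_graph vs)"
  then show False
  proof cases
    case no_edges
    have "{vs ! 0, vs ! (Suc 0 mod length vs)} \<in> edges (cycle_graph vs)"
      using assms by (force simp: cycle_graph_def)
    with no_edges show False by simp
  next
    case (shedding x)
    obtain f :: "int \<Rightarrow> 'a" where f:
      "verts (cycle_graph vs) = range f"
      "\<And>a b. f a = f b \<longleftrightarrow> int n dvd a - b"
      "\<And>a b. {f a, f b} \<in> edges (cycle_graph vs)
         \<longleftrightarrow> int n dvd a - b - 1 \<or> int n dvd a - b + 1"
      using cycle_graph_integer_indexing[OF assms(1-3)] by metis
    have nd: "\<not> int n dvd 1" "\<not> int n dvd 2" "\<not> int n dvd 3" "\<not> int n dvd 5"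
    proof -
      have small: "n = 4 \<or> n \<ge> 6" using assms by linarith
      show "\<not> int n dvd 1" "\<not> int n dvd 2" "\<not> int n dvd 3" "\<not> int n dvd 5"
        using small by (auto dest: zdvd_imp_le)
    qed
    have nd': "\<not> int n dvd - 1" "\<not> int n dvd - 2" "\<not> int n dvd - 3" "\<not> int n dvd - 5"
      using nd by (simp_all only: dvd_minus_iff not_False_eq_True)
    have loop: "{f a} \<notin> edges (cycle_graph vs)" for a using f(3)[of a a] nd(1) nd'(1) by simp
    from shedding(1) f(1) obtain i where i: "x = f i" by auto
    let ?D = "{f (i + 2), f (i - 2)}"
    have "independent (delete_verts (cycle_graph vs) (closed_nbhd (cycle_graph vs) x)) ?D"
      unfolding independent_def using nd nd' loop by (auto simp: i f)
    then obtain y where y: "{x, y} \<in> edges (cycle_graph vs)"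
        "independent (delete_verts (cycle_graph vs) {x}) (?D \<union> {y})"
      using shedding(4) by auto
    have "y \<in> range f" using y(2) f(1) by (auto simp: independent_def)
    then obtain j where j: "y = f j" by auto
    from y(1) have "int n dvd i - j - 1 \<or> int n dvd i - j + 1" unfolding i j f .
    then have "{f (i - 2), y} \<in> edges (cycle_graph vs) \<or> {f (i + 2), y} \<in> edges (cycle_graph vs)"
      unfolding j f by (auto simp: algebra_simps)
    moreover have "f (i - 2) \<noteq> x" "f (i + 2) \<noteq> x" "y \<noteq> x"
      using y(2) unfolding independent_def by auto
    ultimately show False using y(2) f(1) j unfolding independent_def by auto
  qed
qed

section \<open>Leaves of acyclic graphs\<close>

definition contains_cycle :: "'a set set \<Rightarrow> bool" where
  "contains_cycle E \<longleftrightarrow>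
     (\<exists>vs. distinct vs \<and> length vs \<ge> 3 \<and> edges (cycle_graph vs) \<subseteq> E)"

lemma cycle_within_edge_set:
  assumes "simple_graph G" "F \<subseteq> edges G" "contains_cycle F"
  obtains D where "is_cycle_of D G" "edges D \<subseteq> F" "verts D \<subseteq> \<Union>F"
proof -
  obtain vs where vs: "distinct vs" "length vs \<ge> 3" "edges (cycle_graph vs) \<subseteq> F"
    using assms(3) unfolding contains_cycle_def by blast
  have cover: "verts (cycle_graph vs) \<subseteq> \<Union>F"
  proof
    fix v assume "v \<in> verts (cycle_graph vs)"
    then have "v \<in> set vs" by (simp add: cycle_graph_def)
    then obtain i where i: "i < length vs" "v = vs ! i" by (metis in_set_conv_nth)
    then have "{vs ! i, vs ! (Suc i mod length vs)} \<in> edges (cycle_graph vs)"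
      unfolding cycle_graph_def ugraph.sel by blast
    then have "{vs ! i, vs ! (Suc i mod length vs)} \<in> F" using vs(3) by (rule rev_subsetD)
    then show "v \<in> \<Union>F" unfolding i(2) by (rule UnionI) simp
  qed
  moreover have "\<Union>F \<subseteq> verts G"
    using assms(1,2) unfolding simple_graph_def by blast
  ultimately have "is_cycle_of (cycle_graph vs) G"
    unfolding is_cycle_of_def subgraph_def using vs assms(2) by blast
  then show ?thesis using that vs(3) cover by blast
qed

lemma contains_cycle_mono: "contains_cycle E \<Longrightarrow> E \<subseteq> F \<Longrightarrow> contains_cycle F"
  unfolding contains_cycle_def by blast

text \<open>The first vertex of a longest path is a leaf: a second neighbour would either prolong
  the path or close a cycle with an initial segment of it.\<close>

lemma acyclic_has_leaf:
  assumes fin: "finite E" and two: "\<And>e. e \<in> E \<Longrightarrow> card e = 2" and "E \<noteq> {}"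
    and acyc: "\<not> contains_cycle E"
  obtains z y where "{w. {z, w} \<in> E} = {y}"
proof -
  define P where
    "P = (\<lambda>xs. distinct xs \<and> length xs \<ge> 2 \<and> successively (\<lambda>a b. {a, b} \<in> E) xs)"
  have finU: "finite (\<Union>E)"
    using fin two by (metis card.infinite finite_Union zero_neq_numeral)
  have "length xs \<le> card (\<Union>E)" if "P xs" for xs
  proof -
    have "set xs \<subseteq> \<Union>E"
    proof
      fix v assume "v \<in> set xs"
      then obtain i where i: "i < length xs" "v = xs ! i" by (auto simp: in_set_conv_nth)
      have nth: "{xs ! j, xs ! Suc j} \<in> E" if "Suc j < length xs" for j
        using \<open>P xs\<close> that unfolding P_def successively_conv_nth by blast
      show "v \<in> \<Union>E"
      proof (cases i)
        case 0
        then show ?thesis using nth[of 0] i \<open>P xs\<close> unfolding P_def by auto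
      next
        case (Suc j)
        then show ?thesis using nth[of j] i by auto
      qed
    qed
    then show ?thesis using that card_mono[OF finU] unfolding P_def
      by (metis distinct_card)
  qed
  moreover have "\<exists>xs. P xs"
  proof -
    obtain e where "e \<in> E" using \<open>E \<noteq> {}\<close> by blast
    moreover obtain a b where "e = {a, b}" "a \<noteq> b"
      using two[OF \<open>e \<in> E\<close>] by (auto simp: card_2_iff)
    ultimately have "P [a, b]" by (simp add: P_def)
    then show ?thesis ..
  qed
  ultimately obtain xs where xs: "P xs" and longest: "\<And>ys. P ys \<Longrightarrow> length ys \<le> length xs"
    using ex_has_greatest_nat[of P _ length "card (\<Union>E) + 1"] by (metis less_Suc_eq_le Suc_eq_plus1)
  obtain z y zs where xs_eq: "xs = z # y # zs"
    using xs unfolding P_def by (metis Suc_le_length_iff numeral_2_eq_2)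
  have zy: "{z, y} \<in> E" using xs unfolding P_def xs_eq by simp
  have "w = y" if w: "{z, w} \<in> E" for w
  proof (rule ccontr)
    assume "w \<noteq> y"
    have "w \<noteq> z" using two[OF w] by auto
    show False
    proof (cases "w \<in> set xs")
      case False
      then have "P (w # xs)" using xs w unfolding P_def xs_eq by (simp add: insert_commute)
      from longest[OF this] show False by simp
    next
      case True
      then obtain j where j: "j < length xs" "w = xs ! j" by (auto simp: in_set_conv_nth)
      have "j \<ge> 2" using j \<open>w \<noteq> y\<close> \<open>w \<noteq> z\<close> unfolding xs_eq
        by (cases j; cases "j - 1") auto
      let ?c = "take (Suc j) xs"
      have len: "length ?c = Suc j" using j by simp
      have "{?c ! i, ?c ! (Suc i mod Suc j)} \<in> E" if "i < Suc j" for i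
      proof (cases "i = j")
        case True
        then have "?c ! i = w" "?c ! 0 = z" using j xs_eq by (simp_all del: take_Suc_Cons)
        with True w show ?thesis by (simp add: insert_commute del: take_Suc_Cons)
      next
        case False
        then show ?thesis using that j xs unfolding P_def successively_conv_nth by auto
      qed
      then have "edges (cycle_graph ?c) \<subseteq> E" unfolding cycle_graph_def len by auto
      moreover have "distinct ?c" using xs unfolding P_def by simp
      ultimately show False using acyc \<open>j \<ge> 2\<close> len unfolding contains_cycle_def by force
    qed
  qed
  with zy have "{w. {z, w} \<in> E} = {y}" by blast
  then show ?thesis by (rule that)
qed

lemma acyclic_card_edges:
  assumes "finite E" "\<And>e. e \<in> E \<Longrightarrow> card e = 2" "E \<noteq> {}" "\<not> contains_cycle E"
  shows "card E < card (\<Union>E)"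
  using assms
proof (induction "card E" arbitrary: E rule: less_induct)
  case less
  obtain z y where zy: "{w. {z, w} \<in> E} = {y}"
    using acyclic_has_leaf less.prems by metis
  then have e: "{z, y} \<in> E" by blast
  have zney: "z \<noteq> y" using less.prems(2)[OF e] by auto
  have finU: "finite (\<Union>E)"
    using less.prems(1,2) by (metis card.infinite finite_Union zero_neq_numeral)
  let ?F = "E - {{z, y}}"
  have cE: "card E = Suc (card ?F)" using e less.prems(1) by (metis card_Suc_Diff1)
  show ?case
  proof (cases "?F = {}")
    case True
    then have "E = {{z, y}}" using e by auto
    then show ?thesis using zney by simp
  next
    case False
    have "card ?F < card (\<Union>?F)"
    proof (rule less.hyps)
      show "\<not> contains_cycle ?F" using contains_cycle_mono[of ?F E] less.prems(4) by blast
    qed (use less.prems False cE in auto)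
    moreover have "\<Union>?F \<subseteq> \<Union>E - {z}"
    proof -
      have "z \<notin> a" if a: "a \<in> ?F" for a
      proof
        assume "z \<in> a"
        moreover obtain c d where "a = {c, d}" using less.prems(2) a by (metis DiffD1 card_2_iff)
        ultimately obtain w where "a = {z, w}" by auto
        then show False using a zy by auto
      qed
      then show ?thesis by blast
    qed
    then have "card (\<Union>?F) \<le> card (\<Union>E - {z})" using finU by (intro card_mono) auto
    moreover have "Suc (card (\<Union>E - {z})) = card (\<Union>E)"
      using e finU by (intro card_Suc_Diff1) auto
    ultimately show ?thesis using cE by linarith
  qed
qed

section \<open>Unicyclic graphs\<close>

lemma card_edges_cycle_graph:
  assumes "distinct vs" "length vs \<ge> 3"
  shows "card (edges (cycle_graph vs)) = length vs"
proof -
  let ?n = "length vs"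
  let ?g = "\<lambda>i. {vs ! i, vs ! (Suc i mod ?n)}"
  have "inj_on ?g {..<?n}"
  proof (rule inj_onI)
    fix i j assume ij: "i \<in> {..<?n}" "j \<in> {..<?n}" "?g i = ?g j"
    have lt: "Suc i mod ?n < ?n" "Suc j mod ?n < ?n" using assms(2) by (auto intro!: mod_less_divisor)
    then have "i = j \<or> i = Suc j mod ?n \<and> j = Suc i mod ?n"
      using ij assms(1) by (auto simp: doubleton_eq_iff nth_eq_iff_index_eq)
    then show "i = j" using ij(1,2) assms(2) by (auto simp: mod_Suc split: if_splits)
  qed
  moreover have "edges (cycle_graph vs) = ?g ` {..<?n}" by (auto simp: cycle_graph_def)
  ultimately show ?thesis by (simp add: card_image)
qed

text \<open>Removing one edge from the unique cycle leaves no cycle at all, so the count of edges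
  in an acyclic graph applies to the rest of the cycle together with any further edges \<open>X\<close>.
  This one inequality excludes every configuration that would close a second cycle.\<close>

lemma unique_cycle_card_extra_edges:
  assumes G: "simple_graph G" and C: "C = cycle_graph vs" "distinct vs" "length vs \<ge> 3"
    and unique: "\<And>D. is_cycle_of D G \<Longrightarrow> D = C"
    and sub: "subgraph C G" and X: "X \<subseteq> edges G - edges C"
  shows "card X \<le> card (\<Union>X - verts C)"
proof (rule ccontr)
  assume less: "\<not> ?thesis"
  have finE: "finite (edges G)"
    using G unfolding simple_graph_def by (metis PowI finite_Pow_iff finite_subset subsetI)
  have finV: "finite (\<Union>X - verts C)" "finite (verts C)" "finite X"
    using G X sub finE finite_subset[of "\<Union>X - verts C" "verts G"]
    unfolding simple_graph_def subgraph_def by (auto intro: finite_subset)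
  have cC: "card (edges C) = length vs" "card (verts C) = length vs"
    using card_edges_cycle_graph C by (auto simp: cycle_graph_def distinct_card)
  obtain e where e: "e \<in> edges C" using cC C(3) by fastforce
  let ?F = "edges C - {e} \<union> X"
  have subF: "?F \<subseteq> edges G" using X sub by (auto simp: subgraph_def)
  have finC: "finite (edges C)" using sub finE by (auto simp: subgraph_def intro: finite_subset)
  have "card ?F = card (edges C - {e}) + card X"
    using X finC finV(3) by (intro card_Un_disjoint) auto
  then have cF: "card ?F = length vs - 1 + card X" using e cC by simp
  have "\<not> contains_cycle ?F"
  proof
    assume "contains_cycle ?F"
    then obtain D where "is_cycle_of D G" "edges D \<subseteq> ?F"
      using cycle_within_edge_set[OF G subF] by blast
    moreover have "D = C" using calculation(1) by (rule unique)
    ultimately show False using e X by auto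
  qed
  moreover have "?F \<noteq> {}"
  proof -
    have "card ?F \<noteq> 0" using cF C(3) by linarith
    then show ?thesis by (metis card.empty)
  qed
  ultimately have "card ?F < card (\<Union>?F)"
  proof (intro acyclic_card_edges)
    show "finite ?F" using finC finV(3) by simp
    show "card a = 2" if "a \<in> ?F" for a
      using that subF G unfolding simple_graph_def by blast
  qed
  also have "\<Union>?F \<subseteq> verts C \<union> (\<Union>X - verts C)"
  proof -
    have "a \<subseteq> verts C" if "a \<in> edges C" for a
      using that C(1,3) by (auto simp: cycle_graph_def intro!: nth_mem mod_less_divisor)
    then show ?thesis by blast
  qed
  then have "card (\<Union>?F) \<le> card (verts C) + card (\<Union>X - verts C)"
    using finV(1,2) by (meson card_Un_le card_mono finite_UnI le_trans)
  finally show False using less cF cC C(3) by linarith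
qed

text \<open>Suppose that no cycle vertex carries a leaf. Then every vertex of \<open>Y\<close>, at distance one
  from the cycle, has a neighbour in the set \<open>D\<close> of the vertices at distance two, and \<open>D\<close> is
  independent because an edge inside \<open>D\<close> would close a second cycle. Extend \<open>D\<close> to a maximal
  independent set \<open>S\<close> avoiding the cycle and \<open>Y\<close>. Its closed neighbourhoods cover everything
  but the cycle, so the chordless cycle itself would be vertex decomposable.\<close>

lemma cycle_vertex_carries_leaf:
  assumes G: "simple_graph G" and C: "is_cycle_of C G"
    and unique: "\<And>D. is_cycle_of D G \<Longrightarrow> D = C"
    and vd: "vertex_decomposable G" and n: "card (verts C) \<noteq> 3" "card (verts C) \<noteq> 5"
  obtains p z where "p \<in> verts C" "nbhd G z = {p}"
proof (rule ccontr)
  assume "\<not> thesis"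
  with that have no_leaf: "nbhd G z \<noteq> {p}" if "p \<in> verts C" for p z using that by blast
  let ?C = "verts C" and ?E = "edges G"
  obtain vs where vs: "C = cycle_graph vs" "distinct vs" "length vs \<ge> 3" and sub: "subgraph C G"
    using C unfolding is_cycle_of_def by blast
  have few: "card X \<le> card (\<Union>X - ?C)" if "X \<subseteq> ?E - edges C" for X
    using unique_cycle_card_extra_edges[OF G vs unique sub that] .
  have in_C: "e \<subseteq> ?C" if "e \<in> edges C" for e
    using that vs by (auto simp: cycle_graph_def intro!: nth_mem mod_less_divisor)
  have loop: "{a} \<notin> ?E" for a using G by (auto simp: simple_graph_def)
  have chordless: "{a, b} \<in> edges C" if "{a, b} \<in> ?E" "a \<in> ?C" "b \<in> ?C" for a b
    using few[of "{{a, b}}"] that by auto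
  have one_foot: "p = q" if "y \<notin> ?C" "p \<in> ?C" "q \<in> ?C" "{p, y} \<in> ?E" "{q, y} \<in> ?E" for y p q
  proof (rule ccontr)
    assume "p \<noteq> q"
    moreover have "y \<noteq> p" "y \<noteq> q" using that by auto
    ultimately have "card {{p, y}, {q, y}} = 2" by (simp add: doubleton_eq_iff card_insert_if)
    moreover have "\<Union>{{p, y}, {q, y}} - ?C = {y}" using that by auto
    ultimately show False using few[of "{{p, y}, {q, y}}"] that in_C by auto
  qed
  define Y where "Y = {y. y \<notin> ?C \<and> (\<exists>p\<in>?C. {p, y} \<in> ?E)}"
  define D where "D = {d. d \<notin> ?C \<and> d \<notin> Y \<and> (\<exists>y\<in>Y. {y, d} \<in> ?E)}"
  have Y_indep: "{y, y'} \<notin> ?E" if "y \<in> Y" "y' \<in> Y" for y y'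
  proof
    assume e: "{y, y'} \<in> ?E"
    obtain p p' where p: "y \<notin> ?C" "y' \<notin> ?C" "p \<in> ?C" "p' \<in> ?C" "{p, y} \<in> ?E" "{p', y'} \<in> ?E"
      using \<open>y \<in> Y\<close> \<open>y' \<in> Y\<close> unfolding Y_def by blast
    have "y \<noteq> y'" using e loop by auto
    let ?X = "{{p, y}, {y, y'}, {p', y'}}"
    have "card ?X = 3" using p \<open>y \<noteq> y'\<close> by (auto simp: doubleton_eq_iff card_insert_if)
    moreover have "\<Union>?X - ?C = {y, y'}" using p by auto
    ultimately show False using few[of ?X] p e in_C \<open>y \<noteq> y'\<close> by auto
  qed
  have Y_has_child: "\<exists>d\<in>D. {y, d} \<in> ?E" if "y \<in> Y" for y
  proof -
    obtain p where p: "p \<in> ?C" "{p, y} \<in> ?E" "y \<notin> ?C" using \<open>y \<in> Y\<close> unfolding Y_def by auto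
    then obtain w where w: "{y, w} \<in> ?E" "w \<noteq> p"
      using no_leaf[OF p(1), of y] by (auto simp: nbhd_def insert_commute)
    have "w \<notin> ?C" using one_foot[of y p w] p w by (auto simp: insert_commute)
    moreover have "w \<notin> Y" using Y_indep \<open>y \<in> Y\<close> w by blast
    ultimately show ?thesis using w \<open>y \<in> Y\<close> unfolding D_def by blast
  qed
  have D_indep: "{d, d'} \<notin> ?E" if "d \<in> D" "d' \<in> D" for d d'
  proof
    assume e: "{d, d'} \<in> ?E"
    obtain y y' where y: "y \<in> Y" "y' \<in> Y" "{y, d} \<in> ?E" "{y', d'} \<in> ?E"
      using \<open>d \<in> D\<close> \<open>d' \<in> D\<close> unfolding D_def by blast
    obtain p p' where p: "y \<notin> ?C" "y' \<notin> ?C" "p \<in> ?C" "p' \<in> ?C" "{p, y} \<in> ?E" "{p', y'} \<in> ?E"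
      using y(1,2) unfolding Y_def by blast
    have d: "d \<notin> ?C" "d' \<notin> ?C" "d \<notin> Y" "d' \<notin> Y" using that unfolding D_def by auto
    then have ne: "d \<noteq> d'" "d \<noteq> y" "d \<noteq> y'" "d' \<noteq> y" "d' \<noteq> y'" using y e loop by auto
    \<comment> \<open>These edges bring in one more edge than new vertices, also if \<open>y = y'\<close>.\<close>
    let ?X = "{{p, y}, {y, d}, {d, d'}, {y', d'}, {p', y'}}"
    have X: "?X \<subseteq> ?E - edges C" using p y e d in_C by auto
    show False
    proof (cases "y = y'")
      case True
      then have "p = p'" using one_foot p by blast
      have "card ?X = 4" using True \<open>p = p'\<close> ne p d
        by (auto simp: doubleton_eq_iff card_insert_if)
      moreover have "\<Union>?X - ?C = {y, d, d'}" using p d True by auto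
      ultimately show False using few[OF X] ne True by simp
    next
      case False
      have "card ?X = 5" using False ne p d
        by (auto simp: doubleton_eq_iff card_insert_if)
      moreover have "\<Union>?X - ?C = {y, d, d', y'}" using p d by auto
      ultimately show False using few[OF X] ne False by simp
    qed
  qed
  let ?W = "verts G - ?C - Y"
  let ?I = "{S. S \<subseteq> ?W \<and> (\<forall>u\<in>S. \<forall>v\<in>S. {u, v} \<notin> ?E)}"
  have "finite (verts G)" using G by (simp add: simple_graph_def)
  then have "finite ?I" by (intro finite_subset[of ?I "Pow (verts G)"]) auto
  moreover have "D \<in> ?I" using D_indep unfolding D_def
    by (auto dest: edge_in_verts[OF G])
  ultimately obtain S where S: "S \<in> ?I" "D \<subseteq> S" and maxl: "\<And>T. T \<in> ?I \<Longrightarrow> S \<subseteq> T \<Longrightarrow> S = T"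
    using finite_has_maximal2[of ?I D] by auto
  let ?N = "\<Union>s\<in>S. closed_nbhd G s"
  have "verts G - ?N = ?C"
  proof (intro equalityI subsetI)
    fix v assume v: "v \<in> verts G - ?N"
    show "v \<in> ?C"
    proof (rule ccontr)
      assume "v \<notin> ?C"
      show False
      proof (cases "v \<in> Y")
        case True
        then show False using Y_has_child[OF True] v S(2) by (auto simp: insert_commute)
      next
        case False
        \<comment> \<open>Maximality of \<open>S\<close> covers the vertices at distance more than two, including those
            of other components.\<close>
        have "insert v S \<in> ?I"
          using v S(1) False \<open>v \<notin> ?C\<close> loop by (auto simp: insert_commute)
        from maxl[OF this] show False using v by auto
      qed
    qed
  next
    fix v assume v: "v \<in> ?C"
    have "{s, v} \<notin> ?E" if "s \<in> S" for s
    proof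
      assume "{s, v} \<in> ?E"
      then have "s \<in> Y" using v that S(1) unfolding Y_def by (auto simp: insert_commute)
      then show False using that S(1) by auto
    qed
    moreover have "v \<in> verts G" using v sub by (auto simp: subgraph_def)
    ultimately show "v \<in> verts G - ?N" using v S(1) by auto
  qed
  moreover have "{e \<in> ?E. e \<subseteq> ?C} = edges C"
  proof (intro equalityI subsetI)
    fix e assume e: "e \<in> {e \<in> ?E. e \<subseteq> ?C}"
    then obtain a b where "e = {a, b}"
      using G by (auto simp: simple_graph_def card_2_iff dest!: bspec)
    with e chordless show "e \<in> edges C" by auto
  next
    fix e assume "e \<in> edges C"
    with in_C sub show "e \<in> {e \<in> ?E. e \<subseteq> ?C}" by (auto simp: subgraph_def)
  qed
  ultimately have "delete_verts G ?N = C" by (simp add: delete_verts_def)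
  moreover have "independent G S" using S(1) by (auto simp: independent_def)
  ultimately have "vertex_decomposable C" using vertex_decomposable_link[OF vd G] by metis
  moreover have "card ?C = length vs" using vs by (simp add: cycle_graph_def distinct_card)
  ultimately show False using cycle_graph_not_vertex_decomposable[OF vs(2) refl vs(3)] n vs(1) by simp
qed

section \<open>Truncated expansions\<close>

text \<open>A neighbour of a leaf is shedding: it can always be exchanged for the leaf.\<close>

lemma vertex_decomposable_leaf:
  assumes H: "simple_graph H" and zx: "nbhd H z = {x}"
    and "vertex_decomposable (delete_verts H {x})"
    and "vertex_decomposable (delete_verts H (closed_nbhd H x))"
  shows "vertex_decomposable H"
proof (rule vertex_decomposable.shedding)
  have e: "{z, x} \<in> edges H" "\<And>w. {z, w} \<in> edges H \<Longrightarrow> w = x"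
    using zx by (auto simp: nbhd_def)
  have V: "x \<in> verts H" "z \<in> verts H" "z \<noteq> x"
    using edge_in_verts[OF H e(1)] edge_distinct[OF H e(1)] by auto
  show "x \<in> verts H" by (rule V)
  show "\<forall>D. independent (delete_verts H (closed_nbhd H x)) D \<longrightarrow>
          (\<exists>y\<in>nbhd H x. independent (delete_verts H {x}) (D \<union> {y}))"
  proof (intro allI impI bexI)
    fix D assume D: "independent (delete_verts H (closed_nbhd H x)) D"
    have D1: "D \<subseteq> verts H - closed_nbhd H x" using D by (simp add: independent_def)
    have D2: "{u, v} \<notin> edges H" if "u \<in> D" "v \<in> D" for u v
      using D that unfolding independent_delete by (simp add: independent_def)
    have D3: "{z, u} \<notin> edges H \<and> {u, z} \<notin> edges H" if "u \<in> D" for u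
      using e(2)[of u] that D1 by (auto simp: insert_commute)
    have "{z, z} \<notin> edges H" using edge_distinct[OF H] by blast
    then show "independent (delete_verts H {x}) (D \<union> {z})"
      unfolding independent_def using D1 D2 D3 V by auto
    show "z \<in> nbhd H x" using e(1) by (simp add: insert_commute)
  qed
qed fact+

lemma edges_graph_expansion:
  "{(u, a), (v, b)} \<in> edges (graph_expansion G k)
     \<longleftrightarrow> {u, v} \<in> edges G \<and> a \<in> {1..k} \<and> b \<in> {1..k} \<and> a + b \<le> k + 1"
proof
  assume "{(u, a), (v, b)} \<in> edges (graph_expansion G k)"
  then obtain u' a' v' b' where "{(u, a), (v, b)} = {(u', a'), (v', b')}" "{u', v'} \<in> edges G"
    "a' \<in> {1..k}" "b' \<in> {1..k}" "a' + b' \<le> k + 1"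
    by (auto simp: graph_expansion_def edge_expansion_def)
  then show "{u, v} \<in> edges G \<and> a \<in> {1..k} \<and> b \<in> {1..k} \<and> a + b \<le> k + 1"
    by (auto simp: doubleton_eq_iff insert_commute)
next
  assume e: "{u, v} \<in> edges G \<and> a \<in> {1..k} \<and> b \<in> {1..k} \<and> a + b \<le> k + 1"
  then have "{(u, a), (v, b)} \<in> edges (edge_expansion {u, v} k)"
    unfolding edge_expansion_def by (simp only: ugraph.sel) blast
  with e show "{(u, a), (v, b)} \<in> edges (graph_expansion G k)"
    by (auto simp: graph_expansion_def)
qed

lemma edge_graph_expansion_cases:
  assumes "e \<in> edges (graph_expansion G k)"
  obtains u a v b where "e = {(u, a), (v, b)}"
  using assms by (auto simp: graph_expansion_def edge_expansion_def)

lemma verts_graph_expansion: "verts (graph_expansion G k) = \<Union>(edges G) \<times> {1..k}"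
  by (auto simp: graph_expansion_def edge_expansion_def)

lemma simple_graph_expansion:
  assumes "simple_graph G"
  shows "simple_graph (graph_expansion G k)"
proof -
  have "finite (\<Union>(edges G))"
    using assms unfolding simple_graph_def by (meson Union_least finite_subset)
  moreover have "e \<subseteq> verts (graph_expansion G k) \<and> card e = 2"
    if e_edge: "e \<in> edges (graph_expansion G k)" for e
  proof -
    obtain u a v b where e: "e = {(u, a), (v, b)}"
      using edge_graph_expansion_cases[OF e_edge] by blast
    then have "{u, v} \<in> edges G" "a \<in> {1..k}" "b \<in> {1..k}"
      using that by (auto simp: edges_graph_expansion)
    moreover have "u \<noteq> v" using edge_distinct[OF assms] calculation(1) by blast
    ultimately show ?thesis unfolding e verts_graph_expansion by auto
  qed
  ultimately show ?thesis by (simp add: simple_graph_def verts_graph_expansion)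
qed

definition truncation :: "'a ugraph \<Rightarrow> nat \<Rightarrow> ('a \<Rightarrow> nat) \<Rightarrow> ('a \<times> nat) ugraph" where
  "truncation G k l = delete_verts (graph_expansion G k) {(v, a). a \<le> l v}"

text \<open>The edges of \<open>G\<close> that still carry an edge of the truncation: the lowest remaining
  levels over \<open>u\<close> and \<open>v\<close> are \<open>l u + 1\<close> and \<open>l v + 1\<close>, and they are adjacent if
  \<open>(l u + 1) + (l v + 1) \<le> k + 1\<close>.\<close>

definition live_edges :: "'a ugraph \<Rightarrow> nat \<Rightarrow> ('a \<Rightarrow> nat) \<Rightarrow> 'a set set" where
  "live_edges G k l = {e \<in> edges G. sum l e < k}"

lemma live_edges_iff:
  "simple_graph G \<Longrightarrow> {u, v} \<in> live_edges G k l \<longleftrightarrow> {u, v} \<in> edges G \<and> l u + l v < k"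
  using edge_distinct[of G u v] by (auto simp: live_edges_def)

lemma live_edges_antimono:
  assumes "l \<le> l'"
  shows "live_edges G k l' \<subseteq> live_edges G k l"
  using sum_mono[of _ l l'] assms by (auto simp: live_edges_def le_fun_def intro: le_less_trans)

text \<open>If \<open>y\<close> is the only neighbour of \<open>z\<close> along live edges, then the vertex
  \<open>(z, k - l y)\<close> is a leaf of the truncation, attached to the lowest vertex
  \<open>(y, l y + 1)\<close> over \<open>y\<close>. Both graphs obtained by shedding this vertex are again
  truncations, since the neighbours of \<open>(y, l y + 1)\<close> are the vertices of level at most
  \<open>k - l y\<close> over the neighbours of \<open>y\<close>.\<close>

lemma vertex_decomposable_truncation_step:
  assumes G: "simple_graph G" and z: "{w. {z, w} \<in> live_edges G k l} = {y}"
    and 1: "vertex_decomposable (truncation G k (l(y := Suc (l y))))"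
    and 2: "vertex_decomposable (truncation G k
      (\<lambda>v. if v = y then Suc (l y) else if {y, v} \<in> edges G then max (l v) (k - l y) else l v))"
  shows "vertex_decomposable (truncation G k l)"
proof (rule vertex_decomposable_leaf)
  let ?T = "truncation G k l"
  let ?X = "graph_expansion G k"
  have live: "{z, w} \<in> edges G \<and> l z + l w < k \<longleftrightarrow> w = y" for w
    using z live_edges_iff[OF G] by blast
  have zy: "{z, y} \<in> edges G" "l z + l y < k" using live[of y] by auto
  have VT: "(v, a) \<in> verts ?T \<longleftrightarrow> v \<in> \<Union>(edges G) \<and> l v < a \<and> a \<le> k" for v a
    by (auto simp: truncation_def verts_graph_expansion)
  have ET: "{(u, a), (v, b)} \<in> edges ?T
      \<longleftrightarrow> {u, v} \<in> edges G \<and> l u < a \<and> a \<le> k \<and> l v < b \<and> b \<le> k \<and> a + b \<le> k + 1" for u a v b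
    by (auto simp: truncation_def edges_graph_expansion verts_graph_expansion)
  show "simple_graph ?T"
    unfolding truncation_def by (intro simple_graph_delete simple_graph_expansion G)
  show "nbhd ?T (z, k - l y) = {(y, Suc (l y))}"
  proof (intro set_eqI iffI)
    fix x assume "x \<in> nbhd ?T (z, k - l y)"
    moreover obtain w b where x: "x = (w, b)" by (cases x)
    ultimately have e: "{z, w} \<in> edges G" "l z < k - l y" "l w < b" "k - l y + b \<le> k + 1"
      by (auto simp: ET)
    then have "l z + l w < k" by linarith
    then have "w = y" using live e(1) by blast
    then show "x \<in> {(y, Suc (l y))}" using e x by auto
  next
    fix x assume "x \<in> {(y, Suc (l y))}"
    then show "x \<in> nbhd ?T (z, k - l y)" using zy by (auto simp: ET)
  qed
  have "delete_verts ?T {(y, Suc (l y))} = truncation G k (l(y := Suc (l y)))"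
    unfolding truncation_def delete_delete by (intro delete_cong) (auto split: if_splits)
  then show "vertex_decomposable (delete_verts ?T {(y, Suc (l y))})" using 1 by simp
  define K where "K = closed_nbhd ?T (y, Suc (l y))"
  have K: "(v, a) \<in> K \<longleftrightarrow> v = y \<and> a = Suc (l y) \<or>
      {y, v} \<in> edges G \<and> l v < a \<and> a \<le> k - l y" for v a
    using zy(2) by (auto simp: K_def ET)
  have "{y, y} \<notin> edges G" using edge_distinct[OF G] by blast
  then have "delete_verts ?T K = truncation G k
      (\<lambda>v. if v = y then Suc (l y) else if {y, v} \<in> edges G then max (l v) (k - l y) else l v)"
    unfolding truncation_def delete_delete by (intro delete_cong) (auto simp: K split: if_splits)
  then show "vertex_decomposable (delete_verts ?T (closed_nbhd ?T (y, Suc (l y))))"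
    using 2 unfolding K_def by simp
qed

text \<open>A leaf of the forest of live edges gives a shedding step, and the live edges of both
  resulting truncations are among the previous ones, so they still form a forest.\<close>

lemma vertex_decomposable_truncation_acyclic:
  assumes G: "simple_graph G" and "\<not> contains_cycle (live_edges G k l)"
  shows "vertex_decomposable (truncation G k l)"
  using assms(2)
proof (induction "card (verts (truncation G k l))" arbitrary: l rule: less_induct)
  case less
  let ?L = "live_edges G k l"
  show ?case
  proof (cases "?L = {}")
    case True
    have "edges (truncation G k l) = {}"
    proof (rule equals0I)
      fix e assume e: "e \<in> edges (truncation G k l)"
      obtain u a v b where "e = {(u, a), (v, b)}"
        using e edge_graph_expansion_cases by (force simp: truncation_def)
      then have "{u, v} \<in> edges G \<and> l u < a \<and> l v < b \<and> a + b \<le> k + 1"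
        using e by (auto simp: truncation_def edges_graph_expansion)
      then have "{u, v} \<in> ?L" by (auto simp: live_edges_iff[OF G])
      with True show False by simp
    qed
    then show ?thesis by (rule vertex_decomposable.no_edges)
  next
    case False
    have "finite (edges G)"
      using G unfolding simple_graph_def by (metis PowI finite_Pow_iff finite_subset subsetI)
    then have "finite ?L" "\<And>e. e \<in> ?L \<Longrightarrow> card e = 2"
      using G by (auto simp: live_edges_def simple_graph_def)
    then obtain z y where zy: "{w. {z, w} \<in> ?L} = {y}"
      using acyclic_has_leaf[OF _ _ False less.prems] by metis
    then have e: "{z, y} \<in> edges G" "l z + l y < k" using live_edges_iff[OF G] by blast+
    have smaller: "vertex_decomposable (truncation G k l')"
      if l': "l \<le> l'" "l' y = Suc (l y)" for l'
    proof (rule less.hyps)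
      have "finite (verts (truncation G k l))"
        using simple_graph_expansion[OF G] by (simp add: truncation_def simple_graph_def)
      moreover have "verts (truncation G k l') \<subseteq> verts (truncation G k l)"
        using l'(1) by (auto simp: truncation_def le_fun_def intro: le_trans)
      moreover have "(y, Suc (l y)) \<in> verts (truncation G k l) - verts (truncation G k l')"
        using e l'(2) by (auto simp: truncation_def verts_graph_expansion)
      ultimately show "card (verts (truncation G k l')) < card (verts (truncation G k l))"
        by (intro psubset_card_mono) blast+
      show "\<not> contains_cycle (live_edges G k l')"
        using less.prems contains_cycle_mono[OF _ live_edges_antimono[OF l'(1)]] by blast
    qed
    show ?thesis
      by (rule vertex_decomposable_truncation_step[OF G zy]; rule smaller)
        (auto simp: le_fun_def)
  qed
qed

theorem theorem4p3:
  fixes G C :: "'a ugraph" and n k :: nat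
  assumes "unicyclic G"
    and "is_cycle_of C G" and "card (verts C) = n"
    and "n \<noteq> 3" and "n \<noteq> 5"
    and "vertex_decomposable G"
    and "k \<ge> 1"
  shows "vertex_decomposable (graph_expansion G k)"
proof -
  have G: "simple_graph G" and unique: "\<And>D. is_cycle_of D G \<Longrightarrow> D = C"
    using assms(1,2) unfolding unicyclic_def by auto
  obtain p z where p: "p \<in> verts C" and z: "nbhd G z = {p}"
    using cycle_vertex_carries_leaf[OF G assms(2) unique assms(6)] assms(3-5) by metis
  have acyclic: "\<not> contains_cycle F" if F: "F \<subseteq> edges G" "\<And>e. e \<in> F \<Longrightarrow> p \<notin> e" for F
  proof
    assume "contains_cycle F"
    then obtain D where "is_cycle_of D G" "verts D \<subseteq> \<Union>F"
      using cycle_within_edge_set[OF G F(1)] by blast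
    moreover have "D = C" using calculation(1) by (rule unique)
    ultimately show False using p F(2) by blast
  qed
  \<comment> \<open>The levels over \<open>p\<close> are shed from the bottom, so the induction runs downwards from
      \<open>j = k\<close> to the untruncated expansion at \<open>j = 0\<close>.\<close>
  have "vertex_decomposable (truncation G k ((\<lambda>_. 0)(p := j)))" if "j \<le> k" for j
    using that
  proof (induction j rule: inc_induct)
    case base
    \<comment> \<open>With all levels over \<open>p\<close> gone, no edge at \<open>p\<close> is live.\<close>
    have "p \<notin> e" if e: "e \<in> live_edges G k ((\<lambda>_. 0)(p := k))" for e
    proof
      assume "p \<in> e"
      have "finite e" using e G unfolding live_edges_def simple_graph_def
        by (auto intro: finite_subset)
      then have "sum ((\<lambda>_. 0)(p := k)) e \<ge> k"
        using member_le_sum[of p e "(\<lambda>_. 0)(p := k)"] \<open>p \<in> e\<close> by simp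
      then show False using e by (simp add: live_edges_def)
    qed
    then show ?case
      by (intro vertex_decomposable_truncation_acyclic[OF G] acyclic) (auto simp: live_edges_def)
  next
    case (step j)
    let ?l = "(\<lambda>_. 0)(p := j)"
    have zp: "{z, w} \<in> edges G \<longleftrightarrow> w = p" for w using z by (auto simp: nbhd_def)
    have "z \<noteq> p" using edge_distinct[OF G] zp by blast
    then have leaf: "{w. {z, w} \<in> live_edges G k ?l} = {p}"
      using step zp by (auto simp: live_edges_iff[OF G])
    show ?case
    proof (rule vertex_decomposable_truncation_step[OF G leaf])
      show "vertex_decomposable (truncation G k (?l(p := Suc (?l p))))"
        using step.IH by (simp only: fun_upd_upd fun_upd_same)
      let ?l2 = "\<lambda>v. if v = p then Suc (?l p)
        else if {p, v} \<in> edges G then max (?l v) (k - ?l p) else ?l v"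
      \<comment> \<open>Every neighbour of \<open>p\<close> has lost at least \<open>k - j\<close> levels and \<open>p\<close> has lost
          \<open>j + 1\<close>, which leaves no edge between them.\<close>
      have "p \<notin> e" if e: "e \<in> live_edges G k ?l2" for e
      proof
        assume "p \<in> e"
        moreover obtain a b where "e = {a, b}"
          using e G by (auto simp: live_edges_def simple_graph_def card_2_iff dest!: bspec)
        ultimately obtain v where v: "e = {p, v}" by auto
        have "{p, v} \<in> edges G \<and> ?l2 p + ?l2 v < k"
          using e unfolding v live_edges_iff[OF G] .
        moreover have "v \<noteq> p" using calculation edge_distinct[OF G] by blast
        ultimately show False by (auto split: if_splits)
      qed
      then show "vertex_decomposable (truncation G k ?l2)"
        by (intro vertex_decomposable_truncation_acyclic[OF G] acyclic) (auto simp: live_edges_def)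
    qed
  qed
  from this[of 0] have "vertex_decomposable (truncation G k (\<lambda>_. 0))"
    by (simp add: fun_upd_idem)
  moreover have "truncation G k (\<lambda>_. 0) = graph_expansion G k"
  proof -
    have X: "simple_graph (graph_expansion G k)" by (rule simple_graph_expansion[OF G])
    have "verts (graph_expansion G k) - {(v, a). a \<le> 0} = verts (graph_expansion G k)"
      by (auto simp: verts_graph_expansion)
    then show ?thesis
      using X unfolding truncation_def delete_verts_def simple_graph_def
      by (cases "graph_expansion G k") auto
  qed
  ultimately show ?thesis by simp
qed

end
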